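(* Let $(M,\omega)$ be a closed symplectic manifold and $\mathbb{A}$ a finite-dimensional Poisson-commutative subspace of $C^{\infty}(M)$, with moment map $\Phi\colon M\to\mathbb{A}^\ast$. Let $\zeta_1,\zeta_2\colon C(M)\to\mathbb{R}$ be partial symplectic quasi-states on $(M,\omega)$. Assume that there exist $y_1,y_2\in\Phi(M)$ such that $y_1\neq y_2$ and $\Phi^{-1}(y_i)$ is $\zeta_i$-superheavy for $i=1,2$. Then the functional $\frac{1}{2}(\zeta_1+\zeta_2)\colon C(M)\to\mathbb{R}$ is also a partial symplectic quasi-state on $(M,\omega)$ and (1) $\Phi^{-1}(y_1)\cup\Phi^{-1}(y_2)$ is $\frac{1}{2}(\zeta_1+\zeta_2)$-superheavy; (2) $\Phi^{-1}(y_1)$ and $\Phi^{-1}(y_2)$ are $\frac{1}{2}(\zeta_1+\zeta_2)$-pseudoheavy; (3) $\Phi$ does not admit any $\frac{1}{2}(\zeta_1+\zeta_2)$-heavy fiber.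
   Context: $C(M)$ (resp. $C^\infty(M)$) is the set of continuous (resp. smooth) real-valued functions on $M$. A subspace $\mathbb{A}\subset C^\infty(M)$ is Poisson-commutative if $\{F,G\}=0$ for all $F,G\in\mathbb{A}$; its moment map $\Phi\colon M\to\mathbb{A}^\ast$ is given by $F(x)=\langle\Phi(x),F\rangle$ for $x\in M$, $F\in\mathbb{A}$. For a (smooth) Hamiltonian $H\colon S^1\times M\to\mathbb{R}$ ($S^1=\mathbb{R}/\mathbb{Z}$, $H_t=H(t,\cdot)$), the Hamiltonian vector field is defined by $\iota_{X_{H_t}}\omega=-dH_t$, and $\varphi_H$ is the time-1 map of its flow; $\mathrm{Ham}(M,\omega)$ is the group of all such $\varphi_H$. A subset $X\subset M$ is displaceable from $Y\subset M$ if there is $H$ with $\varphi_H(X)\cap\overline{Y}=\emptyset$. A partial symplectic quasi-state on $(M,\omega)$ is a functional $\zeta\colon C(M)\to\mathbb{R}$ such that: (Normalization) $\zeta(a)=a$ for every constant function $a$; (Stability) $\min_M(H_1-H_2)\le\zeta(H_1)-\zeta(H_2)\le\max_M(H_1-H_2)$ for all $H_1,H_2\in C(M)$; (Semi-homogeneity) $\zeta(sH)=s\zeta(H)$ for all $H\in C(M)$, $s>0$; (Hamiltonian invariance) $\zeta(H\circ\phi)=\zeta(H)$ for all $H\in C(M)$, $\phi\in\mathrm{Ham}(M,\omega)$; (Vanishing) $\zeta(H)=0$ for every $H\in C(M)$ whose support is displaceable from itself; (Quasi-subadditivity) $\zeta(H_1+H_2)\le\zeta(H_1)+\zeta(H_2)$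 for all $H_1,H_2\in C^\infty(M)$ with $\{H_1,H_2\}=0$. For an open $U\subset M$, $\mathcal{H}(U)$ is the set of functions in $C(M)$ whose support is contained in $U$. A closed subset $X\subset M$ is $\zeta$-pseudoheavy if for every open neighborhood $U$ of $X$ there exists $F\in\mathcal{H}(U)$ with $\zeta(F)>0$; it is $\zeta$-heavy (resp. $\zeta$-superheavy) if $\zeta(H)\ge\inf_X H$ (resp. $\zeta(H)\le\sup_X H$) for every $H\in C(M)$. A fiber of $\Phi$ is a set $\Phi^{-1}(y)$ with $y\in\Phi(M)$. *)

theory Defs
  imports "HOL-Analysis.Analysis"
begin

section \<open>Smooth maps between normed spaces\<close>

text \<open>Used on open sets \<open>S\<close> of finite-dimensional spaces, where \<open>C\<^sup>k\<^sup>+\<^sup>1\<close> means: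
  differentiable, with all directional derivatives \<open>C\<^sup>k\<close>.\<close>

primrec Ck_on ::
  "nat \<Rightarrow> 'a::real_normed_vector set \<Rightarrow> ('a \<Rightarrow> 'b::real_normed_vector) \<Rightarrow> bool" where
  "Ck_on 0 S f \<longleftrightarrow> continuous_on S f"
| "Ck_on (Suc k) S f \<longleftrightarrow>
     (\<forall>x\<in>S. f differentiable (at x)) \<and>
     (\<forall>v. Ck_on k S (\<lambda>x. frechet_derivative f (at x) v))"

definition smooth_on ::
  "'a::real_normed_vector set \<Rightarrow> ('a \<Rightarrow> 'b::real_normed_vector) \<Rightarrow> bool" where
  "smooth_on S f \<longleftrightarrow> (\<forall>k. Ck_on k S f)"

section \<open>Closed manifolds\<close>

text \<open>The manifold is the whole type \<open>'m\<close>, with a smooth atlas of charts \<open>(U, \<phi>)\<close>; only the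
  values of \<open>\<phi>\<close> on \<open>U\<close> matter. The model space \<open>'e\<close> is any finite-dimensional normed space
  rather than a \<^class>\<open>euclidean_space\<close>, because the latter has positive dimension.
  Connectedness is not required.\<close>

type_synonym ('m, 'e) chart = "'m set \<times> ('m \<Rightarrow> 'e)"

definition is_chart :: "('m::topological_space, 'e::real_normed_vector) chart \<Rightarrow> bool" where
  "is_chart c \<longleftrightarrow> (case c of (U, \<phi>) \<Rightarrow>
     open U \<and> open (\<phi> ` U) \<and> homeomorphism U (\<phi> ` U) \<phi> (inv_into U \<phi>))"

definition closed_manifold :: "('m::t2_space, 'e::real_normed_vector) chart set \<Rightarrow> bool" where
  "closed_manifold \<A> \<longleftrightarrow>
     (\<exists>B :: 'e set. finite B \<and> span B = UNIV) \<and>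
     compact (UNIV :: 'm set) \<and>
     (\<forall>c\<in>\<A>. is_chart c) \<and>
     (\<Union>c\<in>\<A>. fst c) = UNIV \<and>
     (\<forall>(U, \<phi>)\<in>\<A>. \<forall>(V, \<psi>)\<in>\<A>. smooth_on (\<phi> ` (U \<inter> V)) (\<psi> \<circ> inv_into U \<phi>))"

definition smooth_funs ::
  "('m, 'e::real_normed_vector) chart set \<Rightarrow> ('m \<Rightarrow> real) set" where
  "smooth_funs \<A> = {F. \<forall>(U, \<phi>)\<in>\<A>. smooth_on (\<phi> ` U) (F \<circ> inv_into U \<phi>)}"

definition cont_funs :: "('m::topological_space \<Rightarrow> real) set" where
  "cont_funs = {F. continuous_on UNIV F}"

section \<open>Tangent vectors and vector fields\<close>

text \<open>\<open>T\<^sub>xM\<close> is the space of derivations of \<open>C\<^sup>\<infinity>(M)\<close> at \<open>x\<close>. The functionals are extended by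
  \<open>0\<close> outside \<open>C\<^sup>\<infinity>(M)\<close>, so that equality of tangent vectors is equality of HOL functions.\<close>

type_synonym 'm tvec = "('m \<Rightarrow> real) \<Rightarrow> real"

definition tangent_space ::
  "('m, 'e::real_normed_vector) chart set \<Rightarrow> 'm \<Rightarrow> 'm tvec set" where
  "tangent_space \<A> x = {v.
     (\<forall>F\<in>smooth_funs \<A>. \<forall>G\<in>smooth_funs \<A>. \<forall>a b.
        v (\<lambda>y. a * F y + b * G y) = a * v F + b * v G) \<and>
     (\<forall>F\<in>smooth_funs \<A>. \<forall>G\<in>smooth_funs \<A>.
        v (\<lambda>y. F y * G y) = F x * v G + G x * v F) \<and>
     (\<forall>F. F \<notin> smooth_funs \<A> \<longrightarrow> v F = 0)}"

definition smooth_vector_field ::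
  "('m, 'e::real_normed_vector) chart set \<Rightarrow> ('m \<Rightarrow> 'm tvec) \<Rightarrow> bool" where
  "smooth_vector_field \<A> X \<longleftrightarrow>
     (\<forall>x. X x \<in> tangent_space \<A> x) \<and>
     (\<forall>F\<in>smooth_funs \<A>. (\<lambda>x. X x F) \<in> smooth_funs \<A>)"

definition lie_bracket ::
  "('m \<Rightarrow> 'm tvec) \<Rightarrow> ('m \<Rightarrow> 'm tvec) \<Rightarrow> 'm \<Rightarrow> 'm tvec" where
  "lie_bracket X Y x = (\<lambda>F. X x (\<lambda>y. Y y F) - Y x (\<lambda>y. X y F))"

section \<open>Symplectic forms\<close>

type_synonym 'm two_form = "'m \<Rightarrow> 'm tvec \<Rightarrow> 'm tvec \<Rightarrow> real"

text \<open>A form is a function on \<open>T\<^sub>xM \<times> T\<^sub>xM\<close>, extended by \<open>0\<close> to all pairs of functionals.\<close>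

definition differential_two_form ::
  "('m, 'e::real_normed_vector) chart set \<Rightarrow> 'm two_form \<Rightarrow> bool" where
  "differential_two_form \<A> \<omega> \<longleftrightarrow>
     (\<forall>x. \<forall>v\<in>tangent_space \<A> x. \<forall>w\<in>tangent_space \<A> x. \<forall>u\<in>tangent_space \<A> x. \<forall>a b.
        \<omega> x (\<lambda>F. a * v F + b * w F) u = a * \<omega> x v u + b * \<omega> x w u \<and>
        \<omega> x u (\<lambda>F. a * v F + b * w F) = a * \<omega> x u v + b * \<omega> x u w) \<and>
     (\<forall>x. \<forall>v\<in>tangent_space \<A> x. \<omega> x v v = 0) \<and>
     (\<forall>x v w. v \<notin> tangent_space \<A> x \<or> w \<notin> tangent_space \<A> x \<longrightarrow> \<omega> x v w = 0) \<and>
     (\<forall>X Y. smooth_vector_field \<A> X \<longrightarrow> smooth_vector_field \<A> Y \<longrightarrow>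
        (\<lambda>x. \<omega> x (X x) (Y x)) \<in> smooth_funs \<A>)"

text \<open>\<open>d\<omega> = 0\<close>, by the coordinate-free formula for \<open>d\<omega>(X, Y, Z)\<close>.\<close>

definition closed_two_form ::
  "('m, 'e::real_normed_vector) chart set \<Rightarrow> 'm two_form \<Rightarrow> bool" where
  "closed_two_form \<A> \<omega> \<longleftrightarrow>
     (\<forall>X Y Z. smooth_vector_field \<A> X \<longrightarrow> smooth_vector_field \<A> Y \<longrightarrow>
        smooth_vector_field \<A> Z \<longrightarrow>
        (\<forall>x. X x (\<lambda>y. \<omega> y (Y y) (Z y))
            + Y x (\<lambda>y. \<omega> y (Z y) (X y))
            + Z x (\<lambda>y. \<omega> y (X y) (Y y))
            - \<omega> x (lie_bracket X Y x) (Z x)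
            - \<omega> x (lie_bracket Y Z x) (X x)
            - \<omega> x (lie_bracket Z X x) (Y x) = 0))"

definition nondegenerate_two_form ::
  "('m, 'e::real_normed_vector) chart set \<Rightarrow> 'm two_form \<Rightarrow> bool" where
  "nondegenerate_two_form \<A> \<omega> \<longleftrightarrow>
     (\<forall>x. \<forall>v\<in>tangent_space \<A> x. (\<forall>w\<in>tangent_space \<A> x. \<omega> x v w = 0) \<longrightarrow> v = (\<lambda>F. 0))"

definition closed_symplectic_manifold ::
  "('m::t2_space, 'e::real_normed_vector) chart set \<Rightarrow> 'm two_form \<Rightarrow> bool" where
  "closed_symplectic_manifold \<A> \<omega> \<longleftrightarrow>
     closed_manifold \<A> \<and> differential_two_form \<A> \<omega> \<and>
     closed_two_form \<A> \<omega> \<and> nondegenerate_two_form \<A> \<omega>"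

section \<open>Hamiltonian dynamics\<close>

text \<open>The sign convention is \<open>\<iota>\<^bsub>X\<^esub>\<omega> = -dF\<close>, and \<open>dF(w) = w F\<close> for a derivation \<open>w\<close>. For smooth \<open>F\<close>
  the vector below exists and is unique because \<open>\<omega>\<close> is nondegenerate and \<open>T\<^sub>xM\<close> is
  finite-dimensional.\<close>

definition hamiltonian_vf ::
  "('m, 'e::real_normed_vector) chart set \<Rightarrow> 'm two_form \<Rightarrow> ('m \<Rightarrow> real) \<Rightarrow> 'm \<Rightarrow> 'm tvec" where
  "hamiltonian_vf \<A> \<omega> F x =
     (THE v. v \<in> tangent_space \<A> x \<and> (\<forall>w\<in>tangent_space \<A> x. \<omega> x v w = - w F))"

text \<open>\<open>{F, G} = \<omega>(X\<^sub>G, X\<^sub>F) = dF(X\<^sub>G)\<close>; only the vanishing of the bracket is used, so its sign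
  is immaterial.\<close>

definition poisson_bracket ::
  "('m, 'e::real_normed_vector) chart set \<Rightarrow> 'm two_form \<Rightarrow>
   ('m \<Rightarrow> real) \<Rightarrow> ('m \<Rightarrow> real) \<Rightarrow> 'm \<Rightarrow> real" where
  "poisson_bracket \<A> \<omega> F G x = \<omega> x (hamiltonian_vf \<A> \<omega> G x) (hamiltonian_vf \<A> \<omega> F x)"

text \<open>Functions on \<open>S\<^sup>1 \<times> M\<close>, with \<open>S\<^sup>1 = \<real>/\<int>\<close>, are the functions on \<open>\<real> \<times> M\<close> that are
  \<open>1\<close>-periodic in the first variable.\<close>

definition hamiltonians ::
  "('m, 'e::real_normed_vector) chart set \<Rightarrow> (real \<Rightarrow> 'm \<Rightarrow> real) set" where
  "hamiltonians \<A> = {H.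
     (\<forall>t x. H (t + 1) x = H t x) \<and>
     (\<forall>(U, \<phi>)\<in>\<A>. smooth_on (UNIV \<times> \<phi> ` U) (\<lambda>(t, u). H t (inv_into U \<phi> u)))}"

text \<open>The velocity of a curve \<open>\<gamma>\<close> at time \<open>t\<close> is the derivation \<open>F \<mapsto> (F \<circ> \<gamma>)'(t)\<close>.\<close>

definition is_hamiltonian_flow ::
  "('m, 'e::real_normed_vector) chart set \<Rightarrow> 'm two_form \<Rightarrow>
   (real \<Rightarrow> 'm \<Rightarrow> real) \<Rightarrow> (real \<Rightarrow> 'm \<Rightarrow> 'm) \<Rightarrow> bool" where
  "is_hamiltonian_flow \<A> \<omega> H \<Psi> \<longleftrightarrow>
     (\<forall>x. \<Psi> 0 x = x) \<and>
     (\<forall>t x. \<forall>F\<in>smooth_funs \<A>.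
        ((\<lambda>s. F (\<Psi> s x)) has_real_derivative hamiltonian_vf \<A> \<omega> (H t) (\<Psi> t x) F) (at t))"

definition Ham ::
  "('m, 'e::real_normed_vector) chart set \<Rightarrow> 'm two_form \<Rightarrow> ('m \<Rightarrow> 'm) set" where
  "Ham \<A> \<omega> = {\<Psi> 1 | H \<Psi>. H \<in> hamiltonians \<A> \<and> is_hamiltonian_flow \<A> \<omega> H \<Psi>}"

definition displaceable ::
  "('m::topological_space, 'e::real_normed_vector) chart set \<Rightarrow> 'm two_form \<Rightarrow>
   'm set \<Rightarrow> 'm set \<Rightarrow> bool" where
  "displaceable \<A> \<omega> X Y \<longleftrightarrow> (\<exists>\<phi>\<in>Ham \<A> \<omega>. \<phi> ` X \<inter> closure Y = {})"

section \<open>Poisson-commutative subspaces and moment maps\<close>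

definition finite_dim_subspace :: "('m \<Rightarrow> real) set \<Rightarrow> bool" where
  "finite_dim_subspace \<AA> \<longleftrightarrow>
     (\<lambda>x. 0) \<in> \<AA> \<and>
     (\<forall>F\<in>\<AA>. \<forall>G\<in>\<AA>. (\<lambda>x. F x + G x) \<in> \<AA>) \<and>
     (\<forall>F\<in>\<AA>. \<forall>a. (\<lambda>x. a * F x) \<in> \<AA>) \<and>
     (\<exists>B. finite B \<and> B \<subseteq> \<AA> \<and> (\<forall>F\<in>\<AA>. \<exists>c. F = (\<lambda>x. \<Sum>b\<in>B. c b * b x)))"

definition poisson_commutative ::
  "('m, 'e::real_normed_vector) chart set \<Rightarrow> 'm two_form \<Rightarrow> ('m \<Rightarrow> real) set \<Rightarrow> bool" where
  "poisson_commutative \<A> \<omega> \<AA> \<longleftrightarrow>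
     \<AA> \<subseteq> smooth_funs \<A> \<and> (\<forall>F\<in>\<AA>. \<forall>G\<in>\<AA>. \<forall>x. poisson_bracket \<A> \<omega> F G x = 0)"

text \<open>Elements of the dual space \<open>\<AA>\<^sup>*\<close> are linear functionals on \<open>\<AA>\<close>, represented as
  extensional functions so that distinct values are distinct functionals on \<open>\<AA>\<close>.\<close>

definition moment_map :: "('m \<Rightarrow> real) set \<Rightarrow> 'm \<Rightarrow> ('m \<Rightarrow> real) \<Rightarrow> real" where
  "moment_map \<AA> x = (\<lambda>F\<in>\<AA>. F x)"

section \<open>Partial symplectic quasi-states\<close>

definition supp :: "('m::topological_space \<Rightarrow> real) \<Rightarrow> 'm set" where
  "supp F = closure {x. F x \<noteq> 0}"

text \<open>Functionals on \<open>C(M)\<close> are HOL functions on all of \<open>'m \<Rightarrow> real\<close>, of which only the values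
  on \<open>C(M)\<close> are ever constrained or used. As \<open>M\<close> is compact and nonempty, the infimum and supremum
  in the stability axiom are the minimum and maximum over \<open>M\<close>.\<close>

definition partial_symplectic_quasi_state ::
  "('m::topological_space, 'e::real_normed_vector) chart set \<Rightarrow> 'm two_form \<Rightarrow>
   (('m \<Rightarrow> real) \<Rightarrow> real) \<Rightarrow> bool" where
  "partial_symplectic_quasi_state \<A> \<omega> \<zeta> \<longleftrightarrow>
     \<comment> \<open>normalization\<close>
     (\<forall>a. \<zeta> (\<lambda>x. a) = a) \<and>
     \<comment> \<open>stability\<close>
     (\<forall>H\<^sub>1\<in>cont_funs. \<forall>H\<^sub>2\<in>cont_funs.
        (INF x. H\<^sub>1 x - H\<^sub>2 x) \<le> \<zeta> H\<^sub>1 - \<zeta> H\<^sub>2 \<and> \<zeta> H\<^sub>1 - \<zeta> H\<^sub>2 \<le> (SUP x. H\<^sub>1 x - H\<^sub>2 x)) \<and>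
     \<comment> \<open>semi-homogeneity\<close>
     (\<forall>H\<in>cont_funs. \<forall>s>0. \<zeta> (\<lambda>x. s * H x) = s * \<zeta> H) \<and>
     \<comment> \<open>Hamiltonian invariance\<close>
     (\<forall>H\<in>cont_funs. \<forall>\<phi>\<in>Ham \<A> \<omega>. \<zeta> (H \<circ> \<phi>) = \<zeta> H) \<and>
     \<comment> \<open>vanishing\<close>
     (\<forall>H\<in>cont_funs. displaceable \<A> \<omega> (supp H) (supp H) \<longrightarrow> \<zeta> H = 0) \<and>
     \<comment> \<open>quasi-subadditivity\<close>
     (\<forall>H\<^sub>1\<in>smooth_funs \<A>. \<forall>H\<^sub>2\<in>smooth_funs \<A>.
        (\<forall>x. poisson_bracket \<A> \<omega> H\<^sub>1 H\<^sub>2 x = 0) \<longrightarrow>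
        \<zeta> (\<lambda>x. H\<^sub>1 x + H\<^sub>2 x) \<le> \<zeta> H\<^sub>1 + \<zeta> H\<^sub>2)"

definition supported_in :: "'m::topological_space set \<Rightarrow> ('m \<Rightarrow> real) set" where
  "supported_in U = {F \<in> cont_funs. supp F \<subseteq> U}"

definition pseudoheavy ::
  "(('m::topological_space \<Rightarrow> real) \<Rightarrow> real) \<Rightarrow> 'm set \<Rightarrow> bool" where
  "pseudoheavy \<zeta> X \<longleftrightarrow>
     closed X \<and> (\<forall>U. open U \<longrightarrow> X \<subseteq> U \<longrightarrow> (\<exists>F\<in>supported_in U. \<zeta> F > 0))"

text \<open>Infima and suprema over \<open>X\<close> are taken in the extended reals, because \<open>X\<close> may be empty.\<close>

definition heavy ::
  "(('m::topological_space \<Rightarrow> real) \<Rightarrow> real) \<Rightarrow> 'm set \<Rightarrow> bool" where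
  "heavy \<zeta> X \<longleftrightarrow>
     closed X \<and> (\<forall>H\<in>cont_funs. ereal (\<zeta> H) \<ge> (INF x\<in>X. ereal (H x)))"

definition superheavy ::
  "(('m::topological_space \<Rightarrow> real) \<Rightarrow> real) \<Rightarrow> 'm set \<Rightarrow> bool" where
  "superheavy \<zeta> X \<longleftrightarrow>
     closed X \<and> (\<forall>H\<in>cont_funs. ereal (\<zeta> H) \<le> (SUP x\<in>X. ereal (H x)))"

end

theory Submission
  imports Defs
begin

text \<open>Every axiom of a partial symplectic quasi-state is preserved by averaging, and the average of
  \<open>\<zeta>\<^sub>1(H)\<close> and \<open>\<zeta>\<^sub>2(H)\<close> is at most the larger of the two, which is bounded by the supremum of
  \<open>H\<close> over the union of the superheavy fibers.

  For pseudoheaviness of \<open>X = \<Phi>\<^sup>-\<^sup>1(y\<^sub>1)\<close>, the point is that superheaviness also bounds \<open>\<zeta>\<^sub>1\<close> from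
  below: a smooth \<open>G\<close> Poisson-commutes with \<open>- G\<close> (\<open>poisson_bracket_uminus\<close>), so \<open>\<zeta>\<^sub>1(G) \<ge> - \<zeta>\<^sub>1(- G)\<close>,
  which is at least the infimum of \<open>G\<close> over \<open>X\<close> (\<open>superheavy_smooth_lower_bound\<close>). The fiber is
  the zero set of a smooth function \<open>g \<ge> 0\<close>, a sum of squares of elements of \<open>\<AA>\<close> shifted by
  constants (\<open>moment_map_fiber_defining_function\<close>). By compactness \<open>g\<close> is bounded away from \<open>0\<close>
  outside a given neighborhood of \<open>X\<close>, so for a large constant \<open>c\<close> the positive part of
  \<open>1 - c g\<close> is supported in the neighborhood. It is nonnegative, so \<open>\<zeta>\<^sub>2\<close> is nonnegative on it,
  and it dominates \<open>1 - c g\<close>, so \<open>\<zeta>\<^sub>1\<close> is at least \<open>1\<close> on it (\<open>pseudoheavy_average\<close>).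

  A fiber \<open>\<Phi>\<^sup>-\<^sup>1(y)\<close> differs from one of the two superheavy fibers, say \<open>\<Phi>\<^sup>-\<^sup>1(y\<^sub>1)\<close>. An element of
  \<open>\<AA>\<close> separating them yields a continuous \<open>H \<le> 1\<close> that is \<open>0\<close> on \<open>\<Phi>\<^sup>-\<^sup>1(y\<^sub>1)\<close> and \<open>1\<close> on \<open>\<Phi>\<^sup>-\<^sup>1(y)\<close>. Then
  \<open>\<zeta>\<^sub>1(H) \<le> 0\<close> and \<open>\<zeta>\<^sub>2(H) \<le> 1\<close>, so the average is at most \<open>1 / 2\<close> on \<open>H\<close>, whereas heaviness of
  \<open>\<Phi>\<^sup>-\<^sup>1(y)\<close> would make it at least \<open>1\<close> (\<open>not_heavy_other_fiber\<close>).\<close>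

section \<open>The algebra of smooth functions\<close>

lemma Ck_on_cong:
  assumes "open S" "\<And>x. x \<in> S \<Longrightarrow> f x = g x" "Ck_on k S f"
  shows "Ck_on k S g"
  using assms(2,3)
proof (induction k arbitrary: f g)
  case 0
  then show ?case by (simp cong: continuous_on_cong)
next
  case (Suc k)
  have diff: "g differentiable (at x)"
    and deriv: "frechet_derivative f (at x) v = frechet_derivative g (at x) v"
    if "x \<in> S" for x v
  proof -
    have f: "(f has_derivative frechet_derivative f (at x)) (at x)"
      using Suc.prems(2) that by (simp add: frechet_derivative_works[symmetric])
    have "(g has_derivative frechet_derivative f (at x)) (at x)"
      using has_derivative_transform_within_open[OF f assms(1) that] Suc.prems(1) by simp
    then show "g differentiable (at x)"
      and "frechet_derivative f (at x) v = frechet_derivative g (at x) v"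
      by (auto simp: differentiable_def dest: frechet_derivative_at)
  qed
  have "Ck_on k S (\<lambda>x. frechet_derivative g (at x) v)" for v
  proof (rule Suc.IH)
    show "frechet_derivative f (at x) v = frechet_derivative g (at x) v" if "x \<in> S" for x
      using deriv that .
  qed (use Suc.prems(2) in simp)
  then show ?case using diff by simp
qed

lemma Ck_on_Suc_imp_Ck_on: "Ck_on (Suc k) S f \<Longrightarrow> Ck_on k S f"
proof (induction k arbitrary: f)
  case 0
  then show ?case
    by (auto intro!: continuous_at_imp_continuous_on differentiable_imp_continuous_within)
next
  case (Suc k)
  have "Ck_on k S (\<lambda>x. frechet_derivative f (at x) v)" for v
    using Suc.IH Suc.prems by (metis Ck_on.simps(2))
  then show ?case using Suc.prems by simp
qed

lemma Ck_on_const: "Ck_on k S (\<lambda>x. c)"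
  by (induction k arbitrary: c) (auto simp: frechet_derivative_const)

lemma Ck_on_add:
  assumes "open S"
  shows "Ck_on k S f \<Longrightarrow> Ck_on k S g \<Longrightarrow> Ck_on k S (\<lambda>x. f x + g x)"
proof (induction k arbitrary: f g)
  case 0
  then show ?case by (auto intro: continuous_on_add)
next
  case (Suc k)
  have "Ck_on k S (\<lambda>x. frechet_derivative (\<lambda>x. f x + g x) (at x) v)" for v
  proof (rule Ck_on_cong[OF assms])
    show "frechet_derivative f (at x) v + frechet_derivative g (at x) v
        = frechet_derivative (\<lambda>x. f x + g x) (at x) v" if "x \<in> S" for x
    proof -
      have "(f has_derivative frechet_derivative f (at x)) (at x)"
        and "(g has_derivative frechet_derivative g (at x)) (at x)"
        using Suc.prems that by (simp_all add: frechet_derivative_works[symmetric])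
      from frechet_derivative_at[OF has_derivative_add[OF this]]
      show ?thesis by metis
    qed
    show "Ck_on k S (\<lambda>x. frechet_derivative f (at x) v + frechet_derivative g (at x) v)"
      using Suc.prems by (intro Suc.IH) simp_all
  qed
  then show ?case using Suc.prems by simp
qed

text \<open>By the product rule a derivative of \<open>f g\<close> again consists of products, in which one factor
  is an undifferentiated \<open>f\<close> or \<open>g\<close>; that factor is then used with one degree of
  differentiability fewer than it has.\<close>

lemma Ck_on_mult:
  fixes f g :: "'a::real_normed_vector \<Rightarrow> real"
  assumes "open S"
  shows "Ck_on k S f \<Longrightarrow> Ck_on k S g \<Longrightarrow> Ck_on k S (\<lambda>x. f x * g x)"
proof (induction k arbitrary: f g)
  case 0
  then show ?case by (auto intro: continuous_on_mult)
next
  case (Suc k)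
  have "Ck_on k S (\<lambda>x. frechet_derivative (\<lambda>x. f x * g x) (at x) v)" for v
  proof (rule Ck_on_cong[OF assms])
    show "f x * frechet_derivative g (at x) v + frechet_derivative f (at x) v * g x
        = frechet_derivative (\<lambda>x. f x * g x) (at x) v" if "x \<in> S" for x
    proof -
      have "(f has_derivative frechet_derivative f (at x)) (at x)"
        and "(g has_derivative frechet_derivative g (at x)) (at x)"
        using Suc.prems that by (simp_all add: frechet_derivative_works[symmetric])
      from frechet_derivative_at[OF has_derivative_mult[OF this]]
      show ?thesis by metis
    qed
    show "Ck_on k S (\<lambda>x. f x * frechet_derivative g (at x) v
                       + frechet_derivative f (at x) v * g x)"
      using Suc.prems
      by (intro Ck_on_add[OF assms] Suc.IH Ck_on_Suc_imp_Ck_on[of k S f]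
            Ck_on_Suc_imp_Ck_on[of k S g]) simp_all
  qed
  then show ?case using Suc.prems by (auto intro: differentiable_mult)
qed

lemma const_in_smooth_funs: "(\<lambda>x. c) \<in> smooth_funs \<A>"
  by (auto simp: smooth_funs_def smooth_on_def comp_def Ck_on_const)

lemma closed_manifold_chart_image_open:
  "closed_manifold \<A> \<Longrightarrow> (U, \<phi>) \<in> \<A> \<Longrightarrow> open (\<phi> ` U)"
  by (auto simp: closed_manifold_def is_chart_def)

lemma add_in_smooth_funs:
  assumes "closed_manifold \<A>" "F \<in> smooth_funs \<A>" "G \<in> smooth_funs \<A>"
  shows "(\<lambda>x. F x + G x) \<in> smooth_funs \<A>"
  unfolding smooth_funs_def smooth_on_def
proof (clarify)
  fix U \<phi> k assume c: "(U, \<phi>) \<in> \<A>"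
  then have "Ck_on k (\<phi> ` U) (F \<circ> inv_into U \<phi>)" "Ck_on k (\<phi> ` U) (G \<circ> inv_into U \<phi>)"
    using assms(2,3) by (auto simp: smooth_funs_def smooth_on_def)
  then show "Ck_on k (\<phi> ` U) ((\<lambda>x. F x + G x) \<circ> inv_into U \<phi>)"
    using Ck_on_add[OF closed_manifold_chart_image_open[OF assms(1) c]] by (simp add: comp_def)
qed

lemma mult_in_smooth_funs:
  assumes "closed_manifold \<A>" "F \<in> smooth_funs \<A>" "G \<in> smooth_funs \<A>"
  shows "(\<lambda>x. F x * G x) \<in> smooth_funs \<A>"
  unfolding smooth_funs_def smooth_on_def
proof (clarify)
  fix U \<phi> k assume c: "(U, \<phi>) \<in> \<A>"
  then have "Ck_on k (\<phi> ` U) (F \<circ> inv_into U \<phi>)" "Ck_on k (\<phi> ` U) (G \<circ> inv_into U \<phi>)"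
    using assms(2,3) by (auto simp: smooth_funs_def smooth_on_def)
  then show "Ck_on k (\<phi> ` U) ((\<lambda>x. F x * G x) \<circ> inv_into U \<phi>)"
    using Ck_on_mult[OF closed_manifold_chart_image_open[OF assms(1) c]] by (simp add: comp_def)
qed

lemma sum_in_smooth_funs:
  assumes "closed_manifold \<A>" "finite B" "\<And>b. b \<in> B \<Longrightarrow> F b \<in> smooth_funs \<A>"
  shows "(\<lambda>x. \<Sum>b\<in>B. F b x) \<in> smooth_funs \<A>"
  using assms(2,3)
  by (induction B rule: finite_induct)
     (auto intro: const_in_smooth_funs add_in_smooth_funs[OF assms(1)])

lemma smooth_funs_subset_cont_funs:
  fixes \<A> :: "('m::t2_space, 'e::real_normed_vector) chart set"
  assumes "closed_manifold \<A>"
  shows "smooth_funs \<A> \<subseteq> cont_funs"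
proof
  fix F assume F: "F \<in> smooth_funs \<A>"
  have "isCont F x" for x
  proof -
    have "(\<Union>c\<in>\<A>. fst c) = UNIV"
      using assms by (simp add: closed_manifold_def)
    then obtain U \<phi> where c: "(U, \<phi>) \<in> \<A>" "x \<in> U" by fastforce
    then have "is_chart (U, \<phi>)"
      using assms by (auto simp: closed_manifold_def)
    then have U: "open U" and hom: "homeomorphism U (\<phi> ` U) \<phi> (inv_into U \<phi>)"
      by (auto simp: is_chart_def)
    have "smooth_on (\<phi> ` U) (F \<circ> inv_into U \<phi>)"
      using F c by (auto simp: smooth_funs_def)
    then have "continuous_on (\<phi> ` U) (F \<circ> inv_into U \<phi>)"
      unfolding smooth_on_def by (metis Ck_on.simps(1))
    then have "continuous_on U ((F \<circ> inv_into U \<phi>) \<circ> \<phi>)"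
      using hom continuous_on_compose[of U \<phi>] by (simp add: homeomorphism_def del: o_apply)
    moreover have "((F \<circ> inv_into U \<phi>) \<circ> \<phi>) z = F z" if "z \<in> U" for z
      using hom that by (simp add: homeomorphism_def)
    ultimately have "continuous_on U F"
      using continuous_on_cong[of U U "(F \<circ> inv_into U \<phi>) \<circ> \<phi>" F] by blast
    then show ?thesis using U c(2) by (simp add: continuous_on_eq_continuous_at)
  qed
  then show "F \<in> cont_funs"
    by (simp add: cont_funs_def continuous_at_imp_continuous_on)
qed

section \<open>A function Poisson-commutes with its negative\<close>

lemma tangent_space_lincomb:
  assumes "v \<in> tangent_space \<A> x" "w \<in> tangent_space \<A> x"
  shows "(\<lambda>F. a * v F + b * w F) \<in> tangent_space \<A> x"
  using assms unfolding tangent_space_def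
  by (intro CollectI conjI ballI allI impI) (simp_all add: algebra_simps)

lemma two_form_lincomb_left:
  assumes "differential_two_form \<A> \<omega>"
    and "v \<in> tangent_space \<A> x" "w \<in> tangent_space \<A> x" "u \<in> tangent_space \<A> x"
  shows "\<omega> x (\<lambda>F. a * v F + b * w F) u = a * \<omega> x v u + b * \<omega> x w u"
  using assms unfolding differential_two_form_def by blast

lemma two_form_diagonal:
  assumes "differential_two_form \<A> \<omega>"
  shows "\<omega> x v v = 0"
  using assms unfolding differential_two_form_def by blast

lemma hamiltonian_vf_eqI:
  assumes "differential_two_form \<A> \<omega>" "nondegenerate_two_form \<A> \<omega>"
    and v: "v \<in> tangent_space \<A> x" "\<And>w. w \<in> tangent_space \<A> x \<Longrightarrow> \<omega> x v w = - w F"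
  shows "hamiltonian_vf \<A> \<omega> F x = v"
  unfolding hamiltonian_vf_def
proof (rule the_equality)
  fix v' assume v': "v' \<in> tangent_space \<A> x \<and> (\<forall>w\<in>tangent_space \<A> x. \<omega> x v' w = - w F)"
  let ?d = "\<lambda>F. 1 * v' F + (- 1) * v F"
  have "\<omega> x ?d w = 0" if "w \<in> tangent_space \<A> x" for w
    using two_form_lincomb_left[OF assms(1) _ v(1) that, of v' 1 "- 1"] v(2)[OF that] v' that
    by simp
  then have "?d = (\<lambda>F. 0)"
    using assms(2) tangent_space_lincomb[of v' \<A> x v 1 "- 1"] v(1) v'
    unfolding nondegenerate_two_form_def by blast
  then show "v' = v" by (simp add: fun_eq_iff)
qed (use v in blast)

lemma tangent_vector_uminus:
  assumes "v \<in> tangent_space \<A> x" "F \<in> smooth_funs \<A>"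
  shows "v (\<lambda>y. - F y) = - v F"
proof -
  have "v (\<lambda>y. (- 1) * F y + 0 * F y) = (- 1) * v F + 0 * v F"
    using assms unfolding tangent_space_def by blast
  then show ?thesis by simp
qed

text \<open>If a tangent vector \<open>v\<close> represents \<open>- dG\<close> at \<open>x\<close>, then \<open>- v\<close> represents \<open>dG\<close>, and the bracket
  is \<open>\<omega>(- v, v) = 0\<close>. If no tangent vector represents \<open>- dG\<close>, then none represents \<open>dG\<close> either,
  both definite descriptions denote the same default value, and the bracket vanishes again
  because \<open>\<omega>\<close> is zero on the diagonal, default value included.\<close>

lemma poisson_bracket_uminus:
  assumes \<omega>: "differential_two_form \<A> \<omega>" "nondegenerate_two_form \<A> \<omega>"
    and G: "G \<in> smooth_funs \<A>"
  shows "poisson_bracket \<A> \<omega> G (\<lambda>y. - G y) x = 0"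
proof -
  let ?T = "tangent_space \<A> x"
  have neg_T: "(\<lambda>F. - v F) \<in> ?T" if "v \<in> ?T" for v
    using tangent_space_lincomb[of v \<A> x v "- 1" 0] that by simp
  have neg_\<omega>: "\<omega> x (\<lambda>F. - v F) u = - \<omega> x v u" if "v \<in> ?T" "u \<in> ?T" for v u
    using two_form_lincomb_left[OF \<omega>(1), of v x v u "- 1" 0] that by simp
  show ?thesis
  proof (cases "\<exists>v. v \<in> ?T \<and> (\<forall>w\<in>?T. \<omega> x v w = - w G)")
    case True
    then obtain v where v: "v \<in> ?T" "\<And>w. w \<in> ?T \<Longrightarrow> \<omega> x v w = - w G" by blast
    have "hamiltonian_vf \<A> \<omega> G x = v"
      using v by (intro hamiltonian_vf_eqI[OF \<omega>])
    moreover have "hamiltonian_vf \<A> \<omega> (\<lambda>y. - G y) x = (\<lambda>F. - v F)"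
      using v G by (intro hamiltonian_vf_eqI[OF \<omega>]) (simp_all add: neg_T neg_\<omega> tangent_vector_uminus)
    ultimately show ?thesis
      using neg_\<omega>[OF v(1) v(1)] two_form_diagonal[OF \<omega>(1), of x v]
      by (simp add: poisson_bracket_def)
  next
    case False
    have neg_False: "\<not> (v \<in> ?T \<and> (\<forall>w\<in>?T. \<omega> x v w = - w (\<lambda>y. - G y)))" for v
    proof
      assume v: "v \<in> ?T \<and> (\<forall>w\<in>?T. \<omega> x v w = - w (\<lambda>y. - G y))"
      then have "(\<lambda>F. - v F) \<in> ?T \<and> (\<forall>w\<in>?T. \<omega> x (\<lambda>F. - v F) w = - w G)"
        using G by (simp add: neg_T neg_\<omega> tangent_vector_uminus)
      with False show False by blast
    qed
    have "(\<lambda>v. v \<in> ?T \<and> (\<forall>w\<in>?T. \<omega> x v w = - w G))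
        = (\<lambda>v. v \<in> ?T \<and> (\<forall>w\<in>?T. \<omega> x v w = - w (\<lambda>y. - G y)))"
      using False neg_False by (intro ext) blast
    then have "hamiltonian_vf \<A> \<omega> G x = hamiltonian_vf \<A> \<omega> (\<lambda>y. - G y) x"
      unfolding hamiltonian_vf_def by (rule arg_cong)
    then show ?thesis
      using two_form_diagonal[OF \<omega>(1)] by (simp add: poisson_bracket_def)
  qed
qed

section \<open>Partial symplectic quasi-states\<close>

lemma partial_symplectic_quasi_state_average:
  assumes "partial_symplectic_quasi_state \<A> \<omega> \<zeta>\<^sub>1" "partial_symplectic_quasi_state \<A> \<omega> \<zeta>\<^sub>2"
  shows "partial_symplectic_quasi_state \<A> \<omega> (\<lambda>H. 1 / 2 * (\<zeta>\<^sub>1 H + \<zeta>\<^sub>2 H))"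
proof -
  have stab: "l \<le> 1 / 2 * (a + b) - 1 / 2 * (c + d) \<and> 1 / 2 * (a + b) - 1 / 2 * (c + d) \<le> u"
    if "l \<le> a - c \<and> a - c \<le> u" "l \<le> b - d \<and> b - d \<le> u" for a b c d l u :: real
    using that by argo
  have subadd: "1 / 2 * (a + b) \<le> 1 / 2 * (c + d) + 1 / 2 * (e + f)"
    if "a \<le> c + e" "b \<le> d + f" for a b c d e f :: real
    using that by argo
  show ?thesis
    using assms unfolding partial_symplectic_quasi_state_def
    by (intro conjI ballI allI impI stab subadd) (simp_all add: algebra_simps)
qed

lemma partial_symplectic_quasi_state_mono:
  assumes \<zeta>: "partial_symplectic_quasi_state \<A> \<omega> \<zeta>"
    and "H\<^sub>1 \<in> cont_funs" "H\<^sub>2 \<in> cont_funs" "\<And>x. H\<^sub>1 x \<le> H\<^sub>2 x"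
  shows "\<zeta> H\<^sub>1 \<le> \<zeta> H\<^sub>2"
proof -
  have "\<zeta> H\<^sub>1 - \<zeta> H\<^sub>2 \<le> (SUP x. H\<^sub>1 x - H\<^sub>2 x)"
    using assms unfolding partial_symplectic_quasi_state_def by blast
  also have "\<dots> \<le> 0"
    using assms(4) by (intro cSUP_least) auto
  finally show ?thesis by simp
qed

lemma superheavy_upper_bound:
  assumes "superheavy \<zeta> X" "H \<in> cont_funs" "\<And>x. x \<in> X \<Longrightarrow> H x \<le> a"
  shows "\<zeta> H \<le> a"
proof -
  have "ereal (\<zeta> H) \<le> (SUP x\<in>X. ereal (H x))"
    using assms by (auto simp: superheavy_def)
  also have "\<dots> \<le> ereal a"
    using assms(3) by (intro SUP_least) simp
  finally show ?thesis by simp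
qed

lemma heavy_lower_bound:
  assumes "heavy \<zeta> X" "H \<in> cont_funs" "\<And>x. x \<in> X \<Longrightarrow> a \<le> H x"
  shows "a \<le> \<zeta> H"
proof -
  have "ereal a \<le> (INF x\<in>X. ereal (H x))"
    using assms(3) by (intro INF_greatest) simp
  also have "\<dots> \<le> ereal (\<zeta> H)"
    using assms by (auto simp: heavy_def)
  finally show ?thesis by simp
qed

lemma superheavy_average:
  assumes "superheavy \<zeta>\<^sub>1 X" "superheavy \<zeta>\<^sub>2 Y"
  shows "superheavy (\<lambda>H. 1 / 2 * (\<zeta>\<^sub>1 H + \<zeta>\<^sub>2 H)) (X \<union> Y)"
  unfolding superheavy_def
proof (intro conjI ballI)
  show "closed (X \<union> Y)" using assms by (auto simp: superheavy_def)
next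
  fix H :: "'a \<Rightarrow> real" assume H: "H \<in> cont_funs"
  let ?S = "SUP x\<in>X \<union> Y. ereal (H x)"
  have "ereal (\<zeta>\<^sub>1 H) \<le> (SUP x\<in>X. ereal (H x))" "ereal (\<zeta>\<^sub>2 H) \<le> (SUP x\<in>Y. ereal (H x))"
    using assms H by (auto simp: superheavy_def)
  moreover have "(SUP x\<in>X. ereal (H x)) \<le> ?S" "(SUP x\<in>Y. ereal (H x)) \<le> ?S"
    by (auto intro: SUP_subset_mono)
  ultimately have "ereal (max (\<zeta>\<^sub>1 H) (\<zeta>\<^sub>2 H)) \<le> ?S"
    by (auto simp: max_def)
  moreover have "1 / 2 * (\<zeta>\<^sub>1 H + \<zeta>\<^sub>2 H) \<le> max (\<zeta>\<^sub>1 H) (\<zeta>\<^sub>2 H)" by argo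
  ultimately show "ereal (1 / 2 * (\<zeta>\<^sub>1 H + \<zeta>\<^sub>2 H)) \<le> ?S"
    by (meson ereal_less_eq(3) order_trans)
qed

text \<open>This is heaviness of superheavy sets, restricted to smooth functions. Since \<open>G\<close> and \<open>- G\<close>
  Poisson-commute, quasi-subadditivity gives \<open>0 = \<zeta>(0) \<le> \<zeta>(G) + \<zeta>(- G)\<close>, so the upper bound on
  \<open>\<zeta>(- G)\<close> becomes a lower bound on \<open>\<zeta>(G)\<close>.\<close>

lemma superheavy_smooth_lower_bound:
  assumes M: "closed_symplectic_manifold \<A> \<omega>"
    and \<zeta>: "partial_symplectic_quasi_state \<A> \<omega> \<zeta>" and X: "superheavy \<zeta> X"
    and G: "G \<in> smooth_funs \<A>" and a: "\<And>x. x \<in> X \<Longrightarrow> a \<le> G x"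
  shows "a \<le> \<zeta> G"
proof -
  have man: "closed_manifold \<A>" using M by (simp add: closed_symplectic_manifold_def)
  have neg: "(\<lambda>x. - G x) \<in> smooth_funs \<A>"
    using mult_in_smooth_funs[OF man const_in_smooth_funs[of "- 1"] G] by simp
  have "\<zeta> (\<lambda>x. G x + - G x) \<le> \<zeta> G + \<zeta> (\<lambda>x. - G x)"
    using \<zeta> G neg poisson_bracket_uminus[OF _ _ G, of \<omega>] M
    unfolding partial_symplectic_quasi_state_def closed_symplectic_manifold_def by blast
  moreover have "\<zeta> (\<lambda>x. 0) = 0"
    using \<zeta> by (simp add: partial_symplectic_quasi_state_def)
  moreover have "\<zeta> (\<lambda>x. - G x) \<le> - a"
    using neg smooth_funs_subset_cont_funs[OF man] a
    by (intro superheavy_upper_bound[OF X]) auto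
  ultimately show ?thesis by simp
qed

section \<open>Fibers of the moment map\<close>

lemma moment_map_eq_iff:
  "moment_map \<AA> x = moment_map \<AA> z \<longleftrightarrow> (\<forall>F\<in>\<AA>. F x = F z)"
  by (auto simp: moment_map_def fun_eq_iff restrict_def)

text \<open>With \<open>B\<close> a finite spanning set of \<open>\<AA>\<close>, the function is the squared distance of \<open>\<Phi>\<close> to the
  value at \<open>x\<close> in the coordinates given by \<open>B\<close>. This is where finite dimensionality enters.\<close>

lemma moment_map_fiber_defining_function:
  assumes M: "closed_manifold \<A>" and \<AA>: "finite_dim_subspace \<AA>" "\<AA> \<subseteq> smooth_funs \<A>"
  obtains g where "g \<in> smooth_funs \<A>" "\<And>z. 0 \<le> g z"
    "\<And>z. g z = 0 \<longleftrightarrow> moment_map \<AA> z = moment_map \<AA> x"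
proof -
  obtain B where B: "finite B" "B \<subseteq> \<AA>" "\<forall>F\<in>\<AA>. \<exists>c. F = (\<lambda>x. \<Sum>b\<in>B. c b * b x)"
    using \<AA>(1) unfolding finite_dim_subspace_def by blast
  define g where "g = (\<lambda>z. \<Sum>b\<in>B. (b z + - b x) * (b z + - b x))"
  have "g \<in> smooth_funs \<A>"
    unfolding g_def using B(2) \<AA>(2)
    by (intro sum_in_smooth_funs mult_in_smooth_funs add_in_smooth_funs const_in_smooth_funs M B(1))
       auto
  moreover have "0 \<le> g z" for z
    unfolding g_def by (intro sum_nonneg) simp
  moreover have "g z = 0 \<longleftrightarrow> moment_map \<AA> z = moment_map \<AA> x" for z
  proof -
    have "g z = 0 \<longleftrightarrow> (\<forall>b\<in>B. b z = b x)"
      unfolding g_def by (subst sum_nonneg_eq_0_iff) (auto simp: B(1))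
    also have "\<dots> \<longleftrightarrow> (\<forall>F\<in>\<AA>. F z = F x)"
    proof
      assume eq: "\<forall>b\<in>B. b z = b x"
      show "\<forall>F\<in>\<AA>. F z = F x"
      proof
        fix F assume "F \<in> \<AA>"
        then obtain c where "F = (\<lambda>x. \<Sum>b\<in>B. c b * b x)" using B(3) by blast
        then show "F z = F x" using eq by (auto intro: sum.cong)
      qed
    qed (use B(2) in blast)
    finally show ?thesis by (simp add: moment_map_eq_iff)
  qed
  ultimately show thesis by (rule that)
qed

text \<open>The test function near the zero set of \<open>g\<close> is \<open>F = max 0 G\<close> with \<open>G = 1 - 2 g / \<delta>\<close>, where
  \<open>g \<ge> \<delta>\<close> off the neighborhood. Although \<open>F\<close> is only continuous, it dominates the smooth function
  \<open>G\<close>, to which the lower bound by the values on \<open>X\<close> applies, so \<open>\<zeta>\<^sub>1(F) \<ge> \<zeta>\<^sub>1(G) \<ge> 1\<close>. The second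
  state cannot cancel this, as monotonicity and \<open>F \<ge> 0\<close> give \<open>\<zeta>\<^sub>2(F) \<ge> 0\<close>.\<close>

lemma pseudoheavy_average:
  fixes \<A> :: "('m::t2_space, 'e::real_normed_vector) chart set"
  assumes M: "closed_symplectic_manifold \<A> \<omega>"
    and \<zeta>\<^sub>1: "partial_symplectic_quasi_state \<A> \<omega> \<zeta>\<^sub>1"
    and \<zeta>\<^sub>2: "partial_symplectic_quasi_state \<A> \<omega> \<zeta>\<^sub>2"
    and X: "superheavy \<zeta>\<^sub>1 X"
    and g: "g \<in> smooth_funs \<A>" "\<And>z. 0 \<le> g z" "\<And>z. g z = 0 \<longleftrightarrow> z \<in> X"
  shows "pseudoheavy (\<lambda>H. 1 / 2 * (\<zeta>\<^sub>1 H + \<zeta>\<^sub>2 H)) X"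
  unfolding pseudoheavy_def
proof (intro conjI allI impI)
  show "closed X" using X by (simp add: superheavy_def)
next
  fix U assume U: "open U" "X \<subseteq> U"
  have man: "closed_manifold \<A>" using M by (simp add: closed_symplectic_manifold_def)
  have cont_g: "continuous_on S g" for S
    using g(1) smooth_funs_subset_cont_funs[OF man] continuous_on_subset[OF _ subset_UNIV]
    unfolding cont_funs_def by blast
  have "compact (UNIV :: 'm set)" using man by (simp add: closed_manifold_def)
  then have "compact (- U)"
    using U(1) compact_Int_closed[of UNIV "- U"] by (simp add: closed_Compl)
  have "\<exists>\<delta>>0. \<forall>z\<in>- U. \<delta> \<le> g z"
  proof (cases "- U = {}")
    case True
    then show ?thesis by (intro exI[of _ 1]) auto
  next
    case False
    then obtain p where p: "p \<in> - U" "\<forall>z\<in>- U. g p \<le> g z"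
      using continuous_attains_inf[OF \<open>compact (- U)\<close> _ cont_g] by blast
    then have "g p \<noteq> 0" using g(3) U(2) by blast
    then show ?thesis using p(2) g(2)[of p] by (intro exI[of _ "g p"]) auto
  qed
  then obtain \<delta> where \<delta>: "0 < \<delta>" "\<And>z. z \<notin> U \<Longrightarrow> \<delta> \<le> g z" by auto
  define G where "G = (\<lambda>z. 1 + (- 2 / \<delta>) * g z)"
  define F where "F = (\<lambda>z. max 0 (G z))"
  have G: "G \<in> smooth_funs \<A>"
    unfolding G_def
    by (intro add_in_smooth_funs mult_in_smooth_funs const_in_smooth_funs man g(1))
  have F: "F \<in> cont_funs"
    using \<delta>(1) unfolding F_def G_def cont_funs_def by (auto intro!: continuous_intros cont_g)
  have "supp F \<subseteq> {z. g z \<le> \<delta> / 2}"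
    unfolding supp_def
  proof (rule closure_minimal)
    show "{z. F z \<noteq> 0} \<subseteq> {z. g z \<le> \<delta> / 2}"
      using \<delta>(1) by (auto simp: F_def G_def field_simps max_def split: if_splits)
    show "closed {z. g z \<le> \<delta> / 2}"
      using cont_g by (intro closed_Collect_le) auto
  qed
  also have "\<dots> \<subseteq> U" using \<delta> by force
  finally have "F \<in> supported_in U" using F by (simp add: supported_in_def)
  moreover have "1 \<le> \<zeta>\<^sub>1 F"
  proof -
    have "1 \<le> \<zeta>\<^sub>1 G"
      by (rule superheavy_smooth_lower_bound[OF M \<zeta>\<^sub>1 X G]) (simp add: G_def g(3)[THEN iffD2])
    also have "\<dots> \<le> \<zeta>\<^sub>1 F"
      using G smooth_funs_subset_cont_funs[OF man] F
      by (intro partial_symplectic_quasi_state_mono[OF \<zeta>\<^sub>1]) (auto simp: F_def)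
    finally show ?thesis .
  qed
  moreover have "0 \<le> \<zeta>\<^sub>2 F"
  proof -
    have "\<zeta>\<^sub>2 (\<lambda>x. 0) \<le> \<zeta>\<^sub>2 F"
      using F by (intro partial_symplectic_quasi_state_mono[OF \<zeta>\<^sub>2]) (auto simp: F_def cont_funs_def)
    then show ?thesis using \<zeta>\<^sub>2 by (simp add: partial_symplectic_quasi_state_def)
  qed
  ultimately show "\<exists>F\<in>supported_in U. 1 / 2 * (\<zeta>\<^sub>1 F + \<zeta>\<^sub>2 F) > 0"
    by (intro bexI[of _ F]) auto
qed

text \<open>Some \<open>f \<in> \<AA>\<close> separates the two fibers. Normalize it to be \<open>0\<close> on the superheavy fiber and
  \<open>1\<close> on the other one, and cap it at \<open>1\<close>: then \<open>\<zeta>\<^sub>1 \<le> 0\<close> and \<open>\<zeta>\<^sub>2 \<le> 1\<close> on the resulting \<open>H\<close>, so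
  their average is at most \<open>1 / 2\<close>, below the infimum \<open>1\<close> of \<open>H\<close> on the other fiber. The cap
  gives \<open>\<zeta>\<^sub>2(H) \<le> 1\<close> whatever values \<open>f\<close> takes on \<open>Y\<close>, which may be the other fiber itself.\<close>

lemma not_heavy_other_fiber:
  assumes \<AA>: "\<AA> \<subseteq> cont_funs"
    and X: "superheavy \<zeta>\<^sub>1 (moment_map \<AA> -` {moment_map \<AA> p})" and Y: "superheavy \<zeta>\<^sub>2 Y"
    and ne: "moment_map \<AA> q \<noteq> moment_map \<AA> p"
  shows "\<not> heavy (\<lambda>H. 1 / 2 * (\<zeta>\<^sub>1 H + \<zeta>\<^sub>2 H)) (moment_map \<AA> -` {moment_map \<AA> q})"
proof
  assume heavy: "heavy (\<lambda>H. 1 / 2 * (\<zeta>\<^sub>1 H + \<zeta>\<^sub>2 H)) (moment_map \<AA> -` {moment_map \<AA> q})"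
  obtain f where f: "f \<in> \<AA>" "f q \<noteq> f p"
    using ne by (auto simp: moment_map_eq_iff)
  define H where "H = (\<lambda>z. min 1 ((f z - f p) / (f q - f p)))"
  have H: "H \<in> cont_funs"
    using \<AA> f unfolding H_def cont_funs_def by (auto intro!: continuous_intros)
  have "\<zeta>\<^sub>1 H \<le> 0"
    using f(1) by (intro superheavy_upper_bound[OF X H]) (auto simp: H_def moment_map_eq_iff)
  moreover have "\<zeta>\<^sub>2 H \<le> 1"
    by (intro superheavy_upper_bound[OF Y H]) (auto simp: H_def)
  moreover have "1 \<le> 1 / 2 * (\<zeta>\<^sub>1 H + \<zeta>\<^sub>2 H)"
    using f by (intro heavy_lower_bound[OF heavy H]) (auto simp: H_def moment_map_eq_iff)
  ultimately show False by simp
qed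

theorem proposition3p1:
  fixes \<A> :: "('m::t2_space, 'e::real_normed_vector) chart set"
    and \<omega> :: "'m two_form"
    and \<AA> :: "('m \<Rightarrow> real) set"
    and \<zeta>\<^sub>1 \<zeta>\<^sub>2 :: "('m \<Rightarrow> real) \<Rightarrow> real"
    and y\<^sub>1 y\<^sub>2 :: "('m \<Rightarrow> real) \<Rightarrow> real"
  defines "\<Phi> \<equiv> moment_map \<AA>"
    and "\<zeta> \<equiv> (\<lambda>H. 1 / 2 * (\<zeta>\<^sub>1 H + \<zeta>\<^sub>2 H))"
  assumes "closed_symplectic_manifold \<A> \<omega>"
    and "finite_dim_subspace \<AA>"
    and "poisson_commutative \<A> \<omega> \<AA>"
    and "partial_symplectic_quasi_state \<A> \<omega> \<zeta>\<^sub>1"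
    and "partial_symplectic_quasi_state \<A> \<omega> \<zeta>\<^sub>2"
    and "y\<^sub>1 \<in> range \<Phi>" and "y\<^sub>2 \<in> range \<Phi>" and "y\<^sub>1 \<noteq> y\<^sub>2"
    and "superheavy \<zeta>\<^sub>1 (\<Phi> -` {y\<^sub>1})"
    and "superheavy \<zeta>\<^sub>2 (\<Phi> -` {y\<^sub>2})"
  shows "partial_symplectic_quasi_state \<A> \<omega> \<zeta> \<and>
         superheavy \<zeta> (\<Phi> -` {y\<^sub>1} \<union> \<Phi> -` {y\<^sub>2}) \<and>
         pseudoheavy \<zeta> (\<Phi> -` {y\<^sub>1}) \<and> pseudoheavy \<zeta> (\<Phi> -` {y\<^sub>2}) \<and>
         \<not> (\<exists>y\<in>range \<Phi>. heavy \<zeta> (\<Phi> -` {y}))"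
proof -
  note M = assms(3) and \<zeta>\<^sub>1 = assms(6) and \<zeta>\<^sub>2 = assms(7) and X\<^sub>1 = assms(11) and X\<^sub>2 = assms(12)
  have man: "closed_manifold \<A>" using M by (simp add: closed_symplectic_manifold_def)
  have smooth: "\<AA> \<subseteq> smooth_funs \<A>" using assms(5) by (simp add: poisson_commutative_def)
  then have cont: "\<AA> \<subseteq> cont_funs" using smooth_funs_subset_cont_funs[OF man] by blast
  have \<zeta>_swap: "\<zeta> = (\<lambda>H. 1 / 2 * (\<zeta>\<^sub>2 H + \<zeta>\<^sub>1 H))" by (simp add: \<zeta>_def add.commute)
  obtain x\<^sub>1 x\<^sub>2 where y: "y\<^sub>1 = \<Phi> x\<^sub>1" "y\<^sub>2 = \<Phi> x\<^sub>2" using assms(8,9) by blast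
  have defining: "\<exists>g\<in>smooth_funs \<A>. (\<forall>z. 0 \<le> g z) \<and> (\<forall>z. g z = 0 \<longleftrightarrow> z \<in> \<Phi> -` {\<Phi> x})" for x
    using moment_map_fiber_defining_function[OF man assms(4) smooth, of x]
    unfolding \<Phi>_def by (metis vimage_singleton_eq)
  have "pseudoheavy \<zeta> (\<Phi> -` {y\<^sub>1})"
    using defining[of x\<^sub>1] pseudoheavy_average[OF M \<zeta>\<^sub>1 \<zeta>\<^sub>2 X\<^sub>1] unfolding y(1) \<zeta>_def by blast
  moreover have "pseudoheavy \<zeta> (\<Phi> -` {y\<^sub>2})"
    using defining[of x\<^sub>2] pseudoheavy_average[OF M \<zeta>\<^sub>2 \<zeta>\<^sub>1 X\<^sub>2] unfolding y(2) \<zeta>_swap by blast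
  moreover have "\<not> heavy \<zeta> (\<Phi> -` {\<Phi> q})" for q
  proof (cases "\<Phi> q = y\<^sub>1")
    case False
    then show ?thesis
      using not_heavy_other_fiber[OF cont _ X\<^sub>2, of \<zeta>\<^sub>1 x\<^sub>1 q] X\<^sub>1
      unfolding y(1) \<zeta>_def \<Phi>_def by blast
  next
    case True
    then have "\<Phi> q \<noteq> y\<^sub>2" using assms(10) by simp
    then show ?thesis
      using not_heavy_other_fiber[OF cont _ X\<^sub>1, of \<zeta>\<^sub>2 x\<^sub>2 q] X\<^sub>2
      unfolding y(2) \<zeta>_swap \<Phi>_def by blast
  qed
  ultimately show ?thesis
    using partial_symplectic_quasi_state_average[OF \<zeta>\<^sub>1 \<zeta>\<^sub>2] superheavy_average[OF X\<^sub>1 X\<^sub>2]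
    unfolding \<zeta>_def by blast
qed

end
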